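(* Given $\epsilon>0$ and $\varphi_1(\boldsymbol{\xi},\boldsymbol{\eta})$, consider the terminal value problem in the unknown $\varphi(\boldsymbol{\xi},\boldsymbol{\eta},t)$, $\boldsymbol{\xi},\boldsymbol{\eta}\in\mathbb{R}^m$, $t\in[0,1]$: $$\frac{\partial\varphi}{\partial t}=-\langle\boldsymbol{\eta},\nabla_{\boldsymbol{\xi}}\varphi\rangle+\langle\nabla_{\boldsymbol{\xi}}V(\boldsymbol{\xi})+\kappa\boldsymbol{\eta},\nabla_{\boldsymbol{\eta}}\varphi\rangle-\epsilon\kappa\Delta_{\boldsymbol{\eta}}\varphi,\qquad \varphi(\boldsymbol{\xi},\boldsymbol{\eta},1)=\varphi_1(\boldsymbol{\xi},\boldsymbol{\eta}).$$ Let $s:=1-t$ and $q(\boldsymbol{\xi},\boldsymbol{\eta},s):=\varphi(\boldsymbol{\xi},\boldsymbol{\eta},t)=\varphi(\boldsymbol{\xi},\boldsymbol{\eta},1-s)$. Then $q$ satisfies the initial value problem $$\frac{\partial q}{\partial s}=\langle\boldsymbol{\eta},\nabla_{\boldsymbol{\xi}}q\rangle-\langle\nabla_{\boldsymbol{\xi}}V(\boldsymbol{\xi})+\kappa\boldsymbol{\eta},\nabla_{\boldsymbol{\eta}}q\rangle+\epsilon\kappa\Delta_{\boldsymbol{\eta}}q,\qquad q(\boldsymbol{\xi},\boldsymbol{\eta},0)=\varphi_1(\boldsymbol{\xi},\boldsymbol{\eta}).$$ Further, let $\boldsymbol{\vartheta}:=-\boldsymbol{\eta}$ and $$\widetilde{p}(\boldsymbol{\xi},-\boldsymbol{\eta},s):=q(\boldsymbol{\xi},\boldsymbol{\eta},s)\exp\left(-\frac1\epsilon\left(\frac12\|\boldsymbol{\eta}\|_2^2+V(\boldsymbol{\xi})\right)\right).$$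 Then $p(\boldsymbol{\xi},\boldsymbol{\vartheta},s):=\widetilde{p}(\boldsymbol{\xi},-\boldsymbol{\eta},s)$ satisfies the initial value problem $$\frac{\partial p}{\partial s}=-\langle\boldsymbol{\vartheta},\nabla_{\boldsymbol{\xi}}p\rangle+\nabla_{\boldsymbol{\vartheta}}\cdot\big(p(\nabla_{\boldsymbol{\xi}}V(\boldsymbol{\xi})+\kappa\boldsymbol{\vartheta})\big)+\epsilon\kappa\Delta_{\boldsymbol{\vartheta}}p,$$ $$p(\boldsymbol{\xi},\boldsymbol{\vartheta},0)=q(\boldsymbol{\xi},\boldsymbol{\eta},0)\exp\left(-\frac1\epsilon\left(\frac12\|\boldsymbol{\eta}\|_2^2+V(\boldsymbol{\xi})\right)\right)\quad(\boldsymbol{\eta}=-\boldsymbol{\vartheta}),$$ where $q$ is a smooth solution of the initial value problem $\frac{\partial q}{\partial s}=\langle\boldsymbol{\eta},\nabla_{\boldsymbol{\xi}}q\rangle-\langle\nabla_{\boldsymbol{\xi}}V(\boldsymbol{\xi})+\kappa\boldsymbol{\eta},\nabla_{\boldsymbol{\eta}}q\rangle+\epsilon\kappa\Delta_{\boldsymbol{\eta}}q$, $q(\boldsymbol{\xi},\boldsymbol{\eta},0)=\varphi_1(\boldsymbol{\xi},\boldsymbol{\eta})$, and $V$ is such that $$\int_{\mathbb{R}^m}\int_{\mathbb{R}^m}q(\boldsymbol{\xi},\boldsymbol{\eta},0)\exp\left(-\frac1\epsilon\left(\frac12\|\boldsymbol{\eta}\|_2^2+V(\boldsymbol{\xi})\right)\right)d\boldsymbol{\xi}\,d\boldsymbol{\eta}<\infty\quad\text{for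 all }\epsilon>0.$$
   Context: $\kappa>0$ is a constant. $V:\mathbb{R}^m\to\mathbb{R}$ satisfies $V\in C^2(\mathbb{R}^m)$, $\inf V>-\infty$, and the Hessian of $V$ is uniformly lower bounded. Subscripts on $\nabla$ (gradient), $\nabla\cdot$ (divergence) and $\Delta$ (Laplacian) indicate the vector variable in $\mathbb{R}^m$ with respect to which the Euclidean operator is taken. $\langle\cdot,\cdot\rangle$ and $\|\cdot\|_2$ are the standard Euclidean inner product and norm. *)

theory Defs
  imports "HOL-Analysis.Analysis"
begin

definition grad :: "(real ^ 'm \<Rightarrow> real) \<Rightarrow> real ^ 'm \<Rightarrow> real ^ 'm" where
  "grad f x = (THE D. GDERIV f x :> D)"

definition divergence :: "(real ^ 'm \<Rightarrow> real ^ 'm) \<Rightarrow> real ^ 'm \<Rightarrow> real" where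
  "divergence F x = trace (jacobian F (at x))"

definition laplacian :: "(real ^ 'm \<Rightarrow> real) \<Rightarrow> real ^ 'm \<Rightarrow> real" where
  "laplacian f x = divergence (grad f) x"

definition hessian :: "(real ^ 'm \<Rightarrow> real) \<Rightarrow> real ^ 'm \<Rightarrow> real ^ 'm ^ 'm" where
  "hessian f x = jacobian (grad f) (at x)"

definition twice_differentiable :: "(real ^ 'm \<Rightarrow> real) \<Rightarrow> bool" where
  "twice_differentiable f \<longleftrightarrow>
     (\<forall>x. f differentiable (at x)) \<and> (\<forall>x. grad f differentiable (at x))"

definition C2 :: "(real ^ 'm \<Rightarrow> real) \<Rightarrow> bool" where
  "C2 f \<longleftrightarrow> twice_differentiable f \<and> continuous_on UNIV (hessian f)"

definition hessian_bounded_below :: "(real ^ 'm \<Rightarrow> real) \<Rightarrow> bool" where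
  "hessian_bounded_below f \<longleftrightarrow> (\<exists>c. \<forall>x v. c * (norm v)\<^sup>2 \<le> v \<bullet> (hessian f x *v v))"

(* Existence, at every (xi, eta, t) with t in [0,1], of the derivatives that occur in the kinetic
   equations: first order in xi and t, second order in eta.  It excludes spurious solutions that
   would exploit the arbitrary value of grad, jacobian, ... at points of non-differentiability.
   The time derivative is one-sided at t = 0 and t = 1. *)
definition has_kinetic_derivs :: "(real ^ 'm \<Rightarrow> real ^ 'm \<Rightarrow> real \<Rightarrow> real) \<Rightarrow> bool" where
  "has_kinetic_derivs f \<longleftrightarrow>
     (\<forall>\<xi> \<eta>. \<forall>t\<in>{0..1}.
        (\<lambda>x. f x \<eta> t) differentiable (at \<xi>) \<and>
        twice_differentiable (\<lambda>y. f \<xi> y t) \<and>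
        (\<lambda>\<tau>. f \<xi> \<eta> \<tau>) differentiable (at t within {0..1}))"

(* Smoothness in the sense of classical solutions: f and all derivatives above are jointly
   continuous on R^m x R^m x [0,1].  Every C-infinity function qualifies; C-infinity itself is not
   demanded because the coefficient grad V of the equations is merely C^1. *)
definition smooth_kinetic :: "(real ^ 'm \<Rightarrow> real ^ 'm \<Rightarrow> real \<Rightarrow> real) \<Rightarrow> bool" where
  "smooth_kinetic f \<longleftrightarrow>
     has_kinetic_derivs f \<and>
     continuous_on (UNIV \<times> UNIV \<times> {0..1}) (\<lambda>(\<xi>, \<eta>, t). f \<xi> \<eta> t) \<and>
     continuous_on (UNIV \<times> UNIV \<times> {0..1})
       (\<lambda>(\<xi>, \<eta>, t). vector_derivative (\<lambda>\<tau>. f \<xi> \<eta> \<tau>) (at t within {0..1})) \<and>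
     continuous_on (UNIV \<times> UNIV \<times> {0..1}) (\<lambda>(\<xi>, \<eta>, t). grad (\<lambda>x. f x \<eta> t) \<xi>) \<and>
     continuous_on (UNIV \<times> UNIV \<times> {0..1}) (\<lambda>(\<xi>, \<eta>, t). grad (\<lambda>y. f \<xi> y t) \<eta>) \<and>
     continuous_on (UNIV \<times> UNIV \<times> {0..1}) (\<lambda>(\<xi>, \<eta>, t). hessian (\<lambda>y. f \<xi> y t) \<eta>)"

end

theory Submission
  imports Defs
begin

text \<open>
  The first half is the chain rule for \<open>s = 1 - t\<close>: the slices of \<open>q\<close> in \<open>\<xi>\<close> and \<open>\<eta>\<close> are slices
  of \<open>\<phi>\<close>, so only the sign of the time derivative changes.

  For the second half write \<open>p(\<xi>, \<theta>, s) = q(\<xi>, -\<theta>, s) G\<close> with the Gibbs weight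
  \<open>G = exp (- (\<bar>\<theta>\<bar>\<^sup>2 / 2 + V \<xi>) / \<epsilon>)\<close>.  As \<open>\<nabla>\<^sub>\<theta> G = - (1/\<epsilon>) G \<theta>\<close>, the part of the flux of \<open>p\<close> that is
  proportional to \<open>\<kappa>\<close> collapses: \<open>p \<theta> + \<epsilon> \<nabla>\<^sub>\<theta> p = - \<epsilon> G (\<nabla>\<^sub>\<eta> q)(\<xi>, -\<theta>, s)\<close>.  Taking the divergence
  once more gives
  \<open>\<nabla>\<^sub>\<theta> \<cdot> (p \<theta>) + \<epsilon> \<Delta>\<^sub>\<theta> p = G (\<theta> \<bullet> \<nabla>\<^sub>\<eta> q + \<epsilon> \<Delta>\<^sub>\<eta> q)\<close>, the derivatives of \<open>q\<close> being
  evaluated at \<open>\<eta> = -\<theta>\<close> (lemma \<open>fokker_planck_gibbs\<close>).  In the remaining transport terms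
  \<open>- \<theta> \<bullet> \<nabla>\<^sub>\<xi> p + \<nabla>V \<bullet> \<nabla>\<^sub>\<theta> p\<close> the two contributions of \<open>\<nabla>G\<close> cancel, because \<open>G\<close> is a function of the
  energy, which the Hamiltonian flow conserves.  What is left is \<open>G\<close> times the right-hand side of
  the equation for \<open>q\<close>.
\<close>

section \<open>Gradient and divergence\<close>

lemma grad_eqI:
  assumes "GDERIV f x :> D"
  shows "grad f x = D"
  unfolding grad_def
proof (rule the_equality)
  show "GDERIV f x :> D" by (rule assms)
next
  fix D' assume "GDERIV f x :> D'"
  then have "(\<lambda>h. h \<bullet> D') = (\<lambda>h. h \<bullet> D)"
    using assms unfolding gderiv_def by (rule has_derivative_unique)
  then have "\<forall>h. h \<bullet> D' = h \<bullet> D"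
    by (intro allI) (rule fun_cong)
  then show "D' = D"
    by (rule iffD1[OF vector_eq_ldot])
qed

lemma GDERIV_imp_differentiable: "GDERIV f x :> D \<Longrightarrow> f differentiable (at x)"
  unfolding gderiv_def differentiable_def by blast

lemma GDERIV_grad:
  fixes f :: "real ^ 'm \<Rightarrow> real"
  assumes "f differentiable (at x)"
  shows "GDERIV f x :> grad f x"
proof -
  obtain f' where f': "(f has_derivative f') (at x)"
    using assms by (auto simp: differentiable_def)
  have "f' h = h \<bullet> adjoint f' 1" for h
    using adjoint_works[OF has_derivative_linear[OF f'], of h 1] by simp
  then have "f' = (\<lambda>h. h \<bullet> adjoint f' 1)"
    by (rule ext)
  with f' have "GDERIV f x :> adjoint f' 1"
    unfolding gderiv_def by (rule has_derivative_subst)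
  then show ?thesis
    by (simp only: grad_eqI)
qed

lemma divergence_eq_sum:
  fixes F :: "real ^ 'm \<Rightarrow> real ^ 'm"
  assumes "(F has_derivative F') (at x)"
  shows "divergence F x = (\<Sum>i\<in>UNIV. F' (axis i 1) $ i)"
  by (simp add: divergence_def trace_def jacobian_def matrix_def
      frechet_derivative_at[OF assms, symmetric])

lemma divergence_add:
  fixes F H :: "real ^ 'm \<Rightarrow> real ^ 'm"
  assumes "F differentiable (at x)" "H differentiable (at x)"
  shows "divergence (\<lambda>y. F y + H y) x = divergence F x + divergence H x"
proof -
  obtain F' H' where d: "(F has_derivative F') (at x)" "(H has_derivative H') (at x)"
    using assms by (auto simp: differentiable_def)
  show ?thesis
    by (simp add: divergence_eq_sum[OF has_derivative_add[OF d]] divergence_eq_sum[OF d(1)]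
        divergence_eq_sum[OF d(2)] sum.distrib)
qed

lemma divergence_scaleR:
  fixes F :: "real ^ 'm \<Rightarrow> real ^ 'm" and f :: "real ^ 'm \<Rightarrow> real"
  assumes "GDERIV f x :> D" "F differentiable (at x)"
  shows "divergence (\<lambda>y. f y *\<^sub>R F y) x = D \<bullet> F x + f x * divergence F x"
proof -
  obtain F' where F': "(F has_derivative F') (at x)"
    using assms(2) by (auto simp: differentiable_def)
  have f': "(f has_derivative (\<lambda>h. h \<bullet> D)) (at x)"
    using assms(1) by (simp add: gderiv_def)
  show ?thesis
    by (simp add: divergence_eq_sum[OF has_derivative_scaleR[OF f' F']] divergence_eq_sum[OF F']
        inner_axis' sum.distrib sum_distrib_left inner_vec_def[of D] add.commute)
qed

lemma divergence_const: "divergence (\<lambda>y. a :: real ^ 'm) x = 0"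
  by (simp add: divergence_eq_sum[OF has_derivative_const])

lemma has_derivative_reflect:
  fixes f :: "'a::real_normed_vector \<Rightarrow> 'b::real_normed_vector"
  assumes "(f has_derivative f') (at (- x))"
  shows "((\<lambda>y. f (- y)) has_derivative (\<lambda>h. f' (- h))) (at x)"
  using has_derivative_compose[OF has_derivative_minus[OF has_derivative_ident] assms] .

lemma differentiable_reflect:
  fixes f :: "'a::real_normed_vector \<Rightarrow> 'b::real_normed_vector"
  assumes "f differentiable (at (- x))"
  shows "(\<lambda>y. f (- y)) differentiable (at x)"
  using assms has_derivative_reflect unfolding differentiable_def by blast

lemma divergence_reflect:
  fixes F :: "real ^ 'm \<Rightarrow> real ^ 'm"
  assumes "F differentiable (at (- x))"
  shows "divergence (\<lambda>y. F (- y)) x = - divergence F (- x)"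
proof -
  obtain F' where F': "(F has_derivative F') (at (- x))"
    using assms by (auto simp: differentiable_def)
  show ?thesis
    by (simp add: divergence_eq_sum[OF has_derivative_reflect[OF F']] divergence_eq_sum[OF F']
        linear_neg[OF has_derivative_linear[OF F']] sum_negf)
qed

lemma GDERIV_reflect:
  assumes "GDERIV f (- x) :> D"
  shows "GDERIV (\<lambda>y. f (- y)) x :> - D"
  using has_derivative_reflect[OF assms[unfolded gderiv_def]] by (simp add: gderiv_def)

section \<open>Conjugation with the Gibbs weight\<close>

text \<open>The Gibbs weight at temperature \<open>\<epsilon>\<close> as a function of the velocity \<open>y\<close>; the position enters
  only through the value \<open>c\<close> of the potential.\<close>

definition gibbs :: "real \<Rightarrow> real \<Rightarrow> real ^ 'm \<Rightarrow> real" where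
  "gibbs \<epsilon> c y = exp (- (1 / \<epsilon>) * ((1 / 2) * (norm y)\<^sup>2 + c))"

lemma GDERIV_gibbs: "GDERIV (gibbs \<epsilon> c) y :> - (gibbs \<epsilon> c y / \<epsilon>) *\<^sub>R y"
proof -
  have "((\<lambda>y. exp (- k * ((1 / 2) * (y \<bullet> y) + c))) has_derivative
      (\<lambda>h. h \<bullet> (- (exp (- k * ((1 / 2) * (y \<bullet> y) + c)) * k) *\<^sub>R y))) (at y)" for k
    by (auto intro!: derivative_eq_intros simp: fun_eq_iff inner_commute algebra_simps)
  from this[of "1 / \<epsilon>"] show ?thesis
    by (simp add: gderiv_def gibbs_def[abs_def] power2_norm_eq_inner)
qed

lemma GDERIV_gibbs_potential:
  assumes "GDERIV V x :> D"
  shows "GDERIV (\<lambda>x. gibbs \<epsilon> (V x) y) x :> - (gibbs \<epsilon> (V x) y / \<epsilon>) *\<^sub>R D"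
proof -
  have "((\<lambda>c. exp (- k * (a + c))) has_real_derivative - (exp (- k * (a + c)) * k)) (at c)"
    for k a c :: real
    by (auto intro!: derivative_eq_intros)
  from this[of "1 / \<epsilon>"]
  have "((\<lambda>c. gibbs \<epsilon> c y) has_real_derivative - (gibbs \<epsilon> (V x) y / \<epsilon>)) (at (V x))"
    by (simp add: gibbs_def)
  from GDERIV_DERIV_compose[OF assms this] show ?thesis .
qed

lemma GDERIV_reflect_gibbs:
  fixes u :: "real ^ 'm \<Rightarrow> real"
  assumes "u differentiable (at (- y))"
  shows "GDERIV (\<lambda>y. u (- y) * gibbs \<epsilon> c y) y :>
    - (u (- y) * gibbs \<epsilon> c y / \<epsilon>) *\<^sub>R y - gibbs \<epsilon> c y *\<^sub>R grad u (- y)"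
  using GDERIV_mult[OF GDERIV_reflect[OF GDERIV_grad[OF assms]] GDERIV_gibbs[of \<epsilon> c]]
  by (rule GDERIV_subst) simp

lemma twice_differentiable_reflect_gibbs:
  fixes u :: "real ^ 'm \<Rightarrow> real"
  assumes "twice_differentiable u"
  shows "twice_differentiable (\<lambda>y. u (- y) * gibbs \<epsilon> c y)"
proof -
  have u: "u differentiable (at y)" and gu: "grad u differentiable (at y)" for y
    using assms by (auto simp: twice_differentiable_def)
  let ?w = "\<lambda>y. u (- y) * gibbs \<epsilon> c y"
  have w: "?w differentiable (at y)" for y
    using GDERIV_reflect_gibbs[OF u] by (rule GDERIV_imp_differentiable)
  have "grad ?w = (\<lambda>y. (- (1 / \<epsilon>) * ?w y) *\<^sub>R y - gibbs \<epsilon> c y *\<^sub>R grad u (- y))"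
    using grad_eqI[OF GDERIV_reflect_gibbs[OF u]] by (simp add: fun_eq_iff)
  moreover have "gibbs \<epsilon> c differentiable (at y)" for y :: "real ^ 'm"
    using GDERIV_gibbs by (rule GDERIV_imp_differentiable)
  moreover have "(\<lambda>y. grad u (- y)) differentiable (at y)" for y
    using gu by (rule differentiable_reflect)
  ultimately have "grad ?w differentiable (at y)" for y
    using w by (simp only: differentiable_diff differentiable_scaleR differentiable_mult
        differentiable_const differentiable_ident)
  with w show ?thesis
    by (simp add: twice_differentiable_def)
qed

text \<open>The gradient structure of the Ornstein-Uhlenbeck part: the flux \<open>w y + \<epsilon> \<nabla>w\<close> of a density
  \<open>w = u(- \<cdot>) G\<close> involves no undifferentiated \<open>u\<close>, so its divergence is \<open>G\<close> times a backward
  operator applied to \<open>u\<close>.\<close>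

lemma fokker_planck_gibbs:
  fixes u :: "real ^ 'm \<Rightarrow> real" and c :: real
  assumes u2: "twice_differentiable u" and \<epsilon>: "\<epsilon> \<noteq> 0"
  defines "w \<equiv> \<lambda>y. u (- y) * gibbs \<epsilon> c y"
  shows "divergence (\<lambda>y. w y *\<^sub>R y) y + \<epsilon> * laplacian w y =
    gibbs \<epsilon> c y * (y \<bullet> grad u (- y) + \<epsilon> * laplacian u (- y))"
proof -
  have u: "u differentiable (at z)" and gu: "grad u differentiable (at z)" for z
    using u2 by (auto simp: twice_differentiable_def)
  have w: "w differentiable (at z)" and gw: "grad w differentiable (at z)" for z
    using twice_differentiable_reflect_gibbs[OF u2]
    by (auto simp: twice_differentiable_def w_def)
  have flux: "w z *\<^sub>R z + \<epsilon> *\<^sub>R grad w z = (- \<epsilon> * gibbs \<epsilon> c z) *\<^sub>R grad u (- z)" for z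
    using \<epsilon> unfolding w_def grad_eqI[OF GDERIV_reflect_gibbs[OF u]]
    by (simp add: scaleR_diff_right)
  have "divergence (\<lambda>y. w y *\<^sub>R y) y + \<epsilon> * laplacian w y =
      divergence (\<lambda>y. w y *\<^sub>R y) y + divergence (\<lambda>y. \<epsilon> *\<^sub>R grad w y) y"
    by (simp add: laplacian_def divergence_scaleR[OF GDERIV_const gw])
  also have "\<dots> = divergence (\<lambda>y. w y *\<^sub>R y + \<epsilon> *\<^sub>R grad w y) y"
    by (intro divergence_add[symmetric] differentiable_scaleR differentiable_const
        differentiable_ident w gw)
  also have "\<dots> = divergence (\<lambda>y. (- \<epsilon> * gibbs \<epsilon> c y) *\<^sub>R grad u (- y)) y"
    by (simp only: flux)
  also have "\<dots> = gibbs \<epsilon> c y * (y \<bullet> grad u (- y) + \<epsilon> * laplacian u (- y))"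
  proof -
    have "GDERIV (\<lambda>y. - \<epsilon> * gibbs \<epsilon> c y) y :> gibbs \<epsilon> c y *\<^sub>R y"
      using GDERIV_mult[OF GDERIV_const[of "- \<epsilon>"] GDERIV_gibbs[of \<epsilon> c y]] \<epsilon> by simp
    from divergence_scaleR[OF this differentiable_reflect[OF gu]] show ?thesis
      by (simp add: divergence_reflect[OF gu] laplacian_def algebra_simps)
  qed
  finally show ?thesis .
qed

text \<open>The full velocity operator at a fixed position, where \<open>a\<close> is the value of the potential
  gradient.\<close>

lemma kinetic_fokker_planck_gibbs:
  fixes u :: "real ^ 'm \<Rightarrow> real" and c :: real
  assumes u2: "twice_differentiable u" and \<epsilon>: "\<epsilon> \<noteq> 0"
  defines "w \<equiv> \<lambda>y. u (- y) * gibbs \<epsilon> c y"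
  shows "divergence (\<lambda>y. w y *\<^sub>R (a + \<kappa> *\<^sub>R y)) y + \<epsilon> * \<kappa> * laplacian w y =
    gibbs \<epsilon> c y * (- (u (- y) / \<epsilon>) * (a \<bullet> y) - (a - \<kappa> *\<^sub>R y) \<bullet> grad u (- y)
      + \<epsilon> * \<kappa> * laplacian u (- y))"
proof -
  have u: "u differentiable (at z)" for z
    using u2 by (simp add: twice_differentiable_def)
  have Dw: "GDERIV w y :> - (w y / \<epsilon>) *\<^sub>R y - gibbs \<epsilon> c y *\<^sub>R grad u (- y)"
    unfolding w_def using GDERIV_reflect_gibbs[OF u] .
  note w = GDERIV_imp_differentiable[OF Dw]
  have wy: "(\<lambda>y. w y *\<^sub>R y) differentiable (at y)"
    by (intro differentiable_scaleR differentiable_ident w)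
  have "divergence (\<lambda>y. w y *\<^sub>R (a + \<kappa> *\<^sub>R y)) y =
      divergence (\<lambda>y. w y *\<^sub>R a + \<kappa> *\<^sub>R (w y *\<^sub>R y)) y"
    by (simp add: algebra_simps)
  also have "\<dots> = divergence (\<lambda>y. w y *\<^sub>R a) y + divergence (\<lambda>y. \<kappa> *\<^sub>R (w y *\<^sub>R y)) y"
    by (intro divergence_add differentiable_scaleR differentiable_const differentiable_ident w)
  also have "\<dots> = (- (w y / \<epsilon>) *\<^sub>R y - gibbs \<epsilon> c y *\<^sub>R grad u (- y)) \<bullet> a
      + \<kappa> * divergence (\<lambda>y. w y *\<^sub>R y) y"
    by (simp add: divergence_scaleR[OF Dw differentiable_const] divergence_const
        divergence_scaleR[OF GDERIV_const wy] del: scaleR_scaleR)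
  finally have "divergence (\<lambda>y. w y *\<^sub>R (a + \<kappa> *\<^sub>R y)) y + \<epsilon> * \<kappa> * laplacian w y =
      (- (w y / \<epsilon>) *\<^sub>R y - gibbs \<epsilon> c y *\<^sub>R grad u (- y)) \<bullet> a
      + \<kappa> * (divergence (\<lambda>y. w y *\<^sub>R y) y + \<epsilon> * laplacian w y)"
    by (simp add: algebra_simps)
  also have "\<dots> = (- (w y / \<epsilon>) *\<^sub>R y - gibbs \<epsilon> c y *\<^sub>R grad u (- y)) \<bullet> a
      + \<kappa> * (gibbs \<epsilon> c y * (y \<bullet> grad u (- y) + \<epsilon> * laplacian u (- y)))"
    unfolding w_def fokker_planck_gibbs[OF u2 \<epsilon>] ..
  finally show ?thesis
    by (simp add: w_def inner_diff_left inner_commute algebra_simps)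
qed

section \<open>Time reversal and change of variables\<close>

lemma has_real_derivative_time_reversal:
  fixes f :: "real \<Rightarrow> real"
  assumes "(f has_real_derivative D) (at (1 - s) within {0..1})"
  shows "((\<lambda>\<sigma>. f (1 - \<sigma>)) has_real_derivative - D) (at s within {0..1})"
proof -
  have "((\<lambda>\<sigma>. 1 - \<sigma>) has_real_derivative - 1) (at s within {0..1})"
    by (auto intro!: derivative_eq_intros)
  with DERIV_image_chain[of f D "\<lambda>\<sigma>. 1 - \<sigma>" s "{0..1}" "- 1"] assms show ?thesis
    by (simp add: o_def)
qed

theorem theorem4:
  fixes V :: "real ^ 'm \<Rightarrow> real"
    and \<phi> q ptilde p :: "real ^ 'm \<Rightarrow> real ^ 'm \<Rightarrow> real \<Rightarrow> real"
    and \<phi>1 :: "real ^ 'm \<Rightarrow> real ^ 'm \<Rightarrow> real"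
    and \<kappa> \<epsilon> :: real
  assumes kappa: "\<kappa> > 0"
    and eps: "\<epsilon> > 0"
    and V_C2: "C2 V"
    and V_bdd: "bdd_below (range V)"
    and V_hess: "hessian_bounded_below V"
    and phi_derivs: "has_kinetic_derivs \<phi>"
    and phi_pde: "\<And>\<xi> \<eta> t. t \<in> {0..1} \<Longrightarrow>
      ((\<lambda>\<tau>. \<phi> \<xi> \<eta> \<tau>) has_real_derivative
        (- (\<eta> \<bullet> grad (\<lambda>x. \<phi> x \<eta> t) \<xi>)
         + (grad V \<xi> + \<kappa> *\<^sub>R \<eta>) \<bullet> grad (\<lambda>y. \<phi> \<xi> y t) \<eta>
         - \<epsilon> * \<kappa> * laplacian (\<lambda>y. \<phi> \<xi> y t) \<eta>)) (at t within {0..1})"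
    and phi_terminal: "\<And>\<xi> \<eta>. \<phi> \<xi> \<eta> 1 = \<phi>1 \<xi> \<eta>"
    and q_eq: "\<And>\<xi> \<eta> s. s \<in> {0..1} \<Longrightarrow> q \<xi> \<eta> s = \<phi> \<xi> \<eta> (1 - s)"
    and ptilde_eq: "\<And>\<xi> \<eta> s. s \<in> {0..1} \<Longrightarrow>
      ptilde \<xi> (- \<eta>) s = q \<xi> \<eta> s * exp (- (1 / \<epsilon>) * ((1 / 2) * (norm \<eta>)\<^sup>2 + V \<xi>))"
    and p_eq: "\<And>\<xi> \<eta> \<theta> s. s \<in> {0..1} \<Longrightarrow> \<theta> = - \<eta> \<Longrightarrow> p \<xi> \<theta> s = ptilde \<xi> (- \<eta>) s"
  shows "(has_kinetic_derivs q \<and>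
      (\<forall>\<xi> \<eta>. \<forall>s\<in>{0..1}.
        ((\<lambda>\<sigma>. q \<xi> \<eta> \<sigma>) has_real_derivative
          (\<eta> \<bullet> grad (\<lambda>x. q x \<eta> s) \<xi>
           - (grad V \<xi> + \<kappa> *\<^sub>R \<eta>) \<bullet> grad (\<lambda>y. q \<xi> y s) \<eta>
           + \<epsilon> * \<kappa> * laplacian (\<lambda>y. q \<xi> y s) \<eta>)) (at s within {0..1})) \<and>
      (\<forall>\<xi> \<eta>. q \<xi> \<eta> 0 = \<phi>1 \<xi> \<eta>))
    \<and>
    (smooth_kinetic q \<longrightarrow>
     (\<forall>\<epsilon>'>0. integrable (lborel \<Otimes>\<^sub>M lborel)
        (\<lambda>(\<xi>, \<eta>). q \<xi> \<eta> 0 * exp (- (1 / \<epsilon>') * ((1 / 2) * (norm \<eta>)\<^sup>2 + V \<xi>)))) \<longrightarrow>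
     has_kinetic_derivs p \<and>
      (\<forall>\<xi> \<theta>. \<forall>s\<in>{0..1}.
        ((\<lambda>\<sigma>. p \<xi> \<theta> \<sigma>) has_real_derivative
          (- (\<theta> \<bullet> grad (\<lambda>x. p x \<theta> s) \<xi>)
           + divergence (\<lambda>y. p \<xi> y s *\<^sub>R (grad V \<xi> + \<kappa> *\<^sub>R y)) \<theta>
           + \<epsilon> * \<kappa> * laplacian (\<lambda>y. p \<xi> y s) \<theta>)) (at s within {0..1})) \<and>
      (\<forall>\<xi> \<eta> \<theta>. \<eta> = - \<theta> \<longrightarrow>
        p \<xi> \<theta> 0 = q \<xi> \<eta> 0 * exp (- (1 / \<epsilon>) * ((1 / 2) * (norm \<eta>)\<^sup>2 + V \<xi>))))"
proof -
  have V: "GDERIV V x :> grad V x" for x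
    using V_C2 by (simp add: C2_def twice_differentiable_def GDERIV_grad)
  have phi_x: "(\<lambda>x. \<phi> x \<eta> t) differentiable (at \<xi>)"
    and phi_y: "twice_differentiable (\<lambda>y. \<phi> \<xi> y t)" if "t \<in> {0..1}" for \<xi> \<eta> t
    using phi_derivs that by (auto simp: has_kinetic_derivs_def)
  have q_pde: "((\<lambda>\<sigma>. q \<xi> \<eta> \<sigma>) has_real_derivative
          (\<eta> \<bullet> grad (\<lambda>x. q x \<eta> s) \<xi>
           - (grad V \<xi> + \<kappa> *\<^sub>R \<eta>) \<bullet> grad (\<lambda>y. q \<xi> y s) \<eta>
           + \<epsilon> * \<kappa> * laplacian (\<lambda>y. q \<xi> y s) \<eta>)) (at s within {0..1})"
    if s: "s \<in> {0..1}" for \<xi> \<eta> s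
  proof -
    have "1 - s \<in> {0..1}"
      using s by auto
    from has_real_derivative_time_reversal[OF phi_pde[OF this, of \<xi> \<eta>]]
    have "((\<lambda>\<sigma>. \<phi> \<xi> \<eta> (1 - \<sigma>)) has_real_derivative
          (\<eta> \<bullet> grad (\<lambda>x. q x \<eta> s) \<xi>
           - (grad V \<xi> + \<kappa> *\<^sub>R \<eta>) \<bullet> grad (\<lambda>y. q \<xi> y s) \<eta>
           + \<epsilon> * \<kappa> * laplacian (\<lambda>y. q \<xi> y s) \<eta>)) (at s within {0..1})"
      by (rule back_subst[where P = "\<lambda>D. (_ has_real_derivative D) _"]) (simp add: q_eq[OF s])
    then show ?thesis
      by (rule has_field_derivative_transform_within[OF _ zero_less_one s]) (simp add: q_eq)
  qed
  have q_x: "(\<lambda>x. q x \<eta> s) differentiable (at \<xi>)"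
    and q_y: "twice_differentiable (\<lambda>y. q \<xi> y s)" if "s \<in> {0..1}" for \<xi> \<eta> s
    using that by (simp_all add: q_eq phi_x phi_y)
  have q_derivs: "has_kinetic_derivs q"
    unfolding has_kinetic_derivs_def
    using q_x q_y
      q_pde[THEN has_field_derivative_imp_has_derivative, THEN differentiableI] by blast
  have q_0: "q \<xi> \<eta> 0 = \<phi>1 \<xi> \<eta>" for \<xi> \<eta>
    by (simp add: q_eq phi_terminal)

  have p: "p \<xi> \<theta> s = q \<xi> (- \<theta>) s * gibbs \<epsilon> (V \<xi>) \<theta>" if "s \<in> {0..1}" for \<xi> \<theta> s
    using p_eq[OF that, of \<theta> "- \<theta>" \<xi>] ptilde_eq[OF that, of \<xi> "- \<theta>"] by (simp add: gibbs_def)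
  have p_x: "GDERIV (\<lambda>x. p x \<theta> s) \<xi> :> gibbs \<epsilon> (V \<xi>) \<theta> *\<^sub>R
      (grad (\<lambda>x. q x (- \<theta>) s) \<xi> - (q \<xi> (- \<theta>) s / \<epsilon>) *\<^sub>R grad V \<xi>)"
    if s: "s \<in> {0..1}" for \<xi> \<theta> s
    using GDERIV_mult[OF GDERIV_grad[OF q_x[OF s, of "- \<theta>" \<xi>]]
        GDERIV_gibbs_potential[OF V, of \<epsilon> \<theta> \<xi>]]
    by (simp add: p[OF s] algebra_simps)
  have p_y: "twice_differentiable (\<lambda>y. p \<xi> y s)" if s: "s \<in> {0..1}" for \<xi> s
    using twice_differentiable_reflect_gibbs[OF q_y[OF s]] by (simp add: p[OF s])
  have p_pde: "((\<lambda>\<sigma>. p \<xi> \<theta> \<sigma>) has_real_derivative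
          (- (\<theta> \<bullet> grad (\<lambda>x. p x \<theta> s) \<xi>)
           + divergence (\<lambda>y. p \<xi> y s *\<^sub>R (grad V \<xi> + \<kappa> *\<^sub>R y)) \<theta>
           + \<epsilon> * \<kappa> * laplacian (\<lambda>y. p \<xi> y s) \<theta>)) (at s within {0..1})"
    (is "(_ has_real_derivative ?R) _")
    if s: "s \<in> {0..1}" for \<xi> \<theta> s
  proof -
    let ?G = "gibbs \<epsilon> (V \<xi>) \<theta>" and ?g = "grad V \<xi>"
    let ?qx = "grad (\<lambda>x. q x (- \<theta>) s) \<xi>" and ?qy = "grad (\<lambda>y. q \<xi> y s) (- \<theta>)"
    let ?L = "laplacian (\<lambda>y. q \<xi> y s) (- \<theta>)"
    have velocity: "divergence (\<lambda>y. p \<xi> y s *\<^sub>R (?g + \<kappa> *\<^sub>R y)) \<theta>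
        + \<epsilon> * \<kappa> * laplacian (\<lambda>y. p \<xi> y s) \<theta> =
        ?G * (- (q \<xi> (- \<theta>) s / \<epsilon>) * (?g \<bullet> \<theta>) - (?g - \<kappa> *\<^sub>R \<theta>) \<bullet> ?qy + \<epsilon> * \<kappa> * ?L)"
      using kinetic_fokker_planck_gibbs[OF q_y[OF s]] eps by (simp add: p[OF s])
    have position: "\<theta> \<bullet> grad (\<lambda>x. p x \<theta> s) \<xi> =
        ?G * (\<theta> \<bullet> ?qx - (q \<xi> (- \<theta>) s / \<epsilon>) * (?g \<bullet> \<theta>))"
      by (simp add: grad_eqI[OF p_x[OF s]] inner_diff_right inner_commute)
    have "(- \<theta> \<bullet> ?qx - (?g + \<kappa> *\<^sub>R - \<theta>) \<bullet> ?qy + \<epsilon> * \<kappa> * ?L) * ?G = ?R"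
      using velocity position by (simp add: algebra_simps)
    with DERIV_cmult_right[OF q_pde[OF s, of \<xi> "- \<theta>"], of ?G]
    have "((\<lambda>\<sigma>. q \<xi> (- \<theta>) \<sigma> * ?G) has_real_derivative ?R) (at s within {0..1})"
      by simp
    then show ?thesis
      by (rule has_field_derivative_transform_within[OF _ zero_less_one s]) (simp add: p)
  qed
  have p_derivs: "has_kinetic_derivs p"
    unfolding has_kinetic_derivs_def
    using GDERIV_imp_differentiable[OF p_x] p_y
      p_pde[THEN has_field_derivative_imp_has_derivative, THEN differentiableI] by blast
  have p_0: "p \<xi> \<theta> 0 = q \<xi> \<eta> 0 * exp (- (1 / \<epsilon>) * ((1 / 2) * (norm \<eta>)\<^sup>2 + V \<xi>))"
    if "\<eta> = - \<theta>" for \<xi> \<eta> \<theta>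
    using that by (simp add: p gibbs_def)
  show ?thesis
    using q_derivs q_pde q_0 p_derivs p_pde p_0 by blast
qed

end
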